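(* Let $\Omega\subseteq\mathbb{C}$ be compact, let $\{\psi_j\}_{j=1}^n$ be a basis of $\mathbb{P}_n=\mathrm{span}(\psi_1,\dots,\psi_n)$ satisfying the Haar condition on $\Omega$, let $f:\Omega\to\mathbb{C}$, and let $X=\{x_1,\dots,x_m\}\subseteq\Omega$ be a set of $m\ge n+1$ distinct nodes with $f_j=f(x_j)$. Let $p^*\in\mathbb{P}_n$ be the solution of the linear Chebyshev approximation problem $$\min_{p\in\mathbb{P}_n}\ \max_{1\le j\le m}|f_j-p(x_j)|,$$ and suppose $$\eta_\infty^*=\max_{1\le j\le m}|f_j-p^*(x_j)|>0 .$$ For $q\ge 1$ and $w=[w_1,\dots,w_m]^{T}\in S$ put $$d_q(w)=\min_{p\in\mathbb{P}_n}\sum_{j=1}^m w_j|f_j-p(x_j)|^q .$$ Then the following hold. (1) For every $q\ge 1$, $$\eta_\infty^*=\Big(\max_{w\in S}d_q(w)\Big)^{1/q}.$$ Moreover, every solution $w^*=[w_1^*,\dots,w_m^*]^{T}$ of the problem $\max_{w\in S}d_q(w)$ has at least $n+1$ nonzero weights $w_j^*$ and satisfies $$w_j^*\big(\eta_\infty^*-|f_j-p^*(x_j)|\big)=0,\qquad j=1,2,\dots,m.$$ (2) For every $q>1$ and every solution $w^*$ of $\max_{w\in S}d_q(w)$, $p^*$ is the unique $p\in\mathbb{P}_n$ attaining the minimum $d_q(w^* )=(\eta_\infty^* )^q$, i.e. the unique minimizer over $p\in\mathbb{P}_n$ of $\sum_{j=1}^m w_j^*|f_j-p(x_j)|^q$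.
   Context: The functions $\psi_1,\dots,\psi_n$ are complex-valued continuous functions on $\Omega$, and $\mathbb{P}_n$ is their span over $\mathbb{C}$. The set $\{\psi_i\}_{i=1}^n$ satisfies the Haar condition on $\Omega$ if the $n\times n$ matrix $[\psi_i(x_j)]_{i,j=1}^n$ is invertible for every choice of $n$ distinct points $x_1,\dots,x_n\in\Omega$. Under this condition the solution $p^*$ of the Chebyshev approximation problem on the $m$ nodes exists and is unique (a known fact). The probability simplex is $$S=\Big\{w=[w_1,\dots,w_m]^{T}\in\mathbb{R}^m:\ w_j\ge 0\ \text{for all } j,\ \sum_{j=1}^m w_j=1\Big\}.$$ *)

theory Defs
  imports "HOL-Analysis.Analysis"
begin

text \<open>
  The numbers n of basis functions and m of nodes are the cardinalities of the finite index
  types \<open>'n\<close> and \<open>'m\<close>. The basis functions are total functions of which only the values on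
  \<open>\<Omega>\<close> matter.
\<close>

text \<open>
  The span consists of functions on \<open>\<Omega>\<close>, so its elements are extensional on \<open>\<Omega>\<close>: two of them
  are equal as soon as they agree on \<open>\<Omega>\<close>.
\<close>

definition span_on :: "complex set \<Rightarrow> ('n::finite \<Rightarrow> complex \<Rightarrow> complex) \<Rightarrow> (complex \<Rightarrow> complex) set"
  where "span_on \<Omega> \<psi> = {p. \<exists>c :: 'n \<Rightarrow> complex. p = (\<lambda>z\<in>\<Omega>. \<Sum>i\<in>UNIV. c i * \<psi> i z)}"

definition lin_indep_on :: "complex set \<Rightarrow> ('n::finite \<Rightarrow> complex \<Rightarrow> complex) \<Rightarrow> bool"
  where "lin_indep_on \<Omega> \<psi> \<longleftrightarrow>
    (\<forall>c :: 'n \<Rightarrow> complex. (\<forall>z\<in>\<Omega>. (\<Sum>i\<in>UNIV. c i * \<psi> i z) = 0) \<longrightarrow> (\<forall>i. c i = 0))"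

definition haar_condition :: "complex set \<Rightarrow> ('n::finite \<Rightarrow> complex \<Rightarrow> complex) \<Rightarrow> bool"
  where "haar_condition \<Omega> \<psi> \<longleftrightarrow>
    (\<forall>y :: 'n \<Rightarrow> complex. inj y \<and> range y \<subseteq> \<Omega> \<longrightarrow>
       invertible ((\<chi> i j. \<psi> i (y j)) :: complex ^ 'n ^ 'n))"

definition prob_simplex :: "(real ^ 'm::finite) set"
  where "prob_simplex = {w. (\<forall>j. 0 \<le> w $ j) \<and> (\<Sum>j\<in>UNIV. w $ j) = 1}"

definition max_error :: "(complex \<Rightarrow> complex) \<Rightarrow> ('m::finite \<Rightarrow> complex) \<Rightarrow> (complex \<Rightarrow> complex) \<Rightarrow> real"
  where "max_error f x p = Max (range (\<lambda>j. cmod (f (x j) - p (x j))))"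

definition weighted_error ::
  "(complex \<Rightarrow> complex) \<Rightarrow> ('m::finite \<Rightarrow> complex) \<Rightarrow> real \<Rightarrow> real ^ 'm \<Rightarrow> (complex \<Rightarrow> complex) \<Rightarrow> real"
  where "weighted_error f x q w p = (\<Sum>j\<in>UNIV. w $ j * cmod (f (x j) - p (x j)) powr q)"

text \<open>
  The infimum is a minimum whenever it is attained. Attainment is not built into this definition
  and has to be claimed separately.
\<close>

definition dual_fun ::
  "complex set \<Rightarrow> ('n::finite \<Rightarrow> complex \<Rightarrow> complex) \<Rightarrow> (complex \<Rightarrow> complex) \<Rightarrow>
    ('m::finite \<Rightarrow> complex) \<Rightarrow> real \<Rightarrow> real ^ 'm \<Rightarrow> real"
  where "dual_fun \<Omega> \<psi> f x q w = (INF p\<in>span_on \<Omega> \<psi>. weighted_error f x q w p)"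

end

theory Submission
  imports Defs
begin

text \<open>
  The whole statement is a duality: the weighted least \<open>q\<close>-th power problems bound the minimax
  error from below, and a suitable weight makes the bound sharp.

  One inequality is immediate. For \<open>w\<close> in the simplex, \<open>d\<^sub>q(w)\<close> is at most the weighted error
  of \<open>p\<^sup>*\<close>, which is an average of numbers \<open>\<le> \<eta>\<^sup>q\<close>.

  For the converse let \<open>r\<close> be the vector of residuals of \<open>p\<^sup>*\<close> at the nodes. Because \<open>p\<^sup>*\<close> is a best
  uniform approximation, no element of \<open>P\<^sub>n\<close> shortens all the extremal residuals at once; by
  separation of convex sets there is then a weight \<open>w\<close>, living on the extremal nodes, for which the
  vector \<open>(w\<^sub>j r\<^sub>j)\<^sub>j\<close> is orthogonal to all node values of \<open>P\<^sub>n\<close>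
  (\<open>best_uniform_residual_certificate\<close>). Pairing this vector with the residual \<open>s\<close> of any other
  \<open>p\<close> gives \<open>\<eta>\<^sup>2 \<le> \<eta> * (\<Sum>j. w\<^sub>j |s\<^sub>j|)\<close>, and Jensen's inequality turns the resulting
  bound on the first power into \<open>\<eta>\<^sup>q \<le> \<Sum>j. w\<^sub>j |s\<^sub>j|\<^sup>q\<close>
  (\<open>certificate_imp_weighted_powr_ge\<close>). The same weight thus works for all \<open>q\<close>.

  Hence every maximizer \<open>w\<close> of \<open>d\<^sub>q\<close> has the value \<open>\<eta>\<^sup>q\<close>, and the rest is an analysis of
  equality. The average of the \<open>|r\<^sub>j|\<^sup>q \<le> \<eta>\<^sup>q\<close> equals \<open>\<eta>\<^sup>q\<close>, so \<open>|r\<^sub>j| = \<eta>\<close> wherever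
  \<open>w\<^sub>j \<noteq> 0\<close>. If at most \<open>n\<close> weights were nonzero, the Haar condition would allow interpolation of
  \<open>f\<close> at their nodes, and \<open>d\<^sub>q(w)\<close> would vanish. Finally, for \<open>q > 1\<close> the midpoint of \<open>p\<^sup>*\<close> and
  another minimizer would have a smaller weighted error by strict convexity, unless the two agree on
  the support of \<open>w\<close>; that support has more than \<open>n\<close> points, so the Haar condition forces them to
  coincide.
\<close>

section \<open>Convexity of powers\<close>

text \<open>
  By the mean value theorem the chord slope between \<open>t\<close> and \<open>\<mu>\<close> is the derivative at a point
  strictly in between, and the derivative is strictly increasing. All convexity needed below,
  strict or not, comes from this tangent inequality.
\<close>

lemma powr_strictly_above_tangent:
  fixes t \<mu> q :: real
  assumes "q > 1" and "\<mu> > 0" and "t \<ge> 0" and "t \<noteq> \<mu>"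
  shows "\<mu> powr q + q * \<mu> powr (q - 1) * (t - \<mu>) < t powr q"
proof -
  have deriv: "((\<lambda>s. s powr q) has_real_derivative q * s powr (q - 1)) (at s)" if "s > 0" for s
    using that by (auto intro!: derivative_eq_intros)
  have cont: "continuous_on {a..b} (\<lambda>s. s powr q)" if "a \<ge> 0" for a b :: real
    using that \<open>q > 1\<close> by (intro continuous_on_powr' continuous_on_id continuous_on_const) auto
  show ?thesis
  proof (cases "t < \<mu>")
    case True
    obtain s where s: "t < s" "s < \<mu>"
      and mvt: "\<mu> powr q - t powr q = q * s powr (q - 1) * (\<mu> - t)"
      using mvt[OF True cont[OF \<open>t \<ge> 0\<close>], of "\<lambda>s h. q * s powr (q - 1) * h"]
        deriv[unfolded has_field_derivative_def] \<open>t \<ge> 0\<close> by auto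
    have "s powr (q - 1) < \<mu> powr (q - 1)"
      using s assms by (intro powr_less_mono2) auto
    then have "(\<mu> - t) * (q * s powr (q - 1)) < (\<mu> - t) * (q * \<mu> powr (q - 1))"
      using True assms by simp
    then show ?thesis using mvt by (simp add: algebra_simps)
  next
    case False
    obtain s where s: "\<mu> < s" "s < t" "t powr q - \<mu> powr q = (t - \<mu>) * (q * s powr (q - 1))"
      using MVT2[of \<mu> t "\<lambda>s. s powr q" "\<lambda>s. q * s powr (q - 1)"] deriv False assms by auto
    have "\<mu> powr (q - 1) < s powr (q - 1)"
      using s assms by (intro powr_less_mono2) auto
    then have "(t - \<mu>) * (q * \<mu> powr (q - 1)) < (t - \<mu>) * (q * s powr (q - 1))"
      using False assms by simp
    then show ?thesis using s(3) by (simp add: algebra_simps)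
  qed
qed

lemma powr_above_tangent:
  fixes t \<mu> q :: real
  assumes "q \<ge> 1" and "\<mu> > 0" and "t \<ge> 0"
  shows "\<mu> powr q + q * \<mu> powr (q - 1) * (t - \<mu>) \<le> t powr q"
proof (cases "q = 1 \<or> t = \<mu>")
  case True
  then show ?thesis using assms by auto
next
  case False
  then show ?thesis using powr_strictly_above_tangent[of q \<mu> t] assms by simp
qed

text \<open>
  Jensen's inequality: average the tangent inequality at \<open>\<mu>\<close> over the weights. The linear term
  is then nonnegative because the mean is at least \<open>\<mu>\<close>.
\<close>

lemma powr_weighted_mean_ge:
  fixes w :: "real ^ 'm::finite"
  assumes "w \<in> prob_simplex" and "\<And>j. s j \<ge> 0" and "(\<Sum>j\<in>UNIV. w $ j * s j) \<ge> \<mu>"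
    and "\<mu> > 0" and "q \<ge> 1"
  shows "(\<Sum>j\<in>UNIV. w $ j * s j powr q) \<ge> \<mu> powr q"
proof -
  let ?S = "\<Sum>j\<in>UNIV. w $ j * s j"
  have w: "\<And>j. w $ j \<ge> 0" "(\<Sum>j\<in>UNIV. w $ j) = 1"
    using assms(1) by (auto simp: prob_simplex_def)
  have "\<mu> powr q \<le> \<mu> powr q + q * \<mu> powr (q - 1) * (?S - \<mu>)"
    using assms by simp
  also have "\<dots> = (\<Sum>j\<in>UNIV. w $ j * (\<mu> powr q + q * \<mu> powr (q - 1) * (s j - \<mu>)))"
  proof -
    have "(\<Sum>j\<in>UNIV. w $ j * (\<mu> powr q + q * \<mu> powr (q - 1) * (s j - \<mu>))) =
      (\<Sum>j\<in>UNIV. (\<mu> powr q - q * \<mu> powr (q - 1) * \<mu>) * w $ j + q * \<mu> powr (q - 1) * (w $ j * s j))"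
      by (intro sum.cong) (auto simp: algebra_simps)
    also have "\<dots> = (\<mu> powr q - q * \<mu> powr (q - 1) * \<mu>) * (\<Sum>j\<in>UNIV. w $ j) + q * \<mu> powr (q - 1) * ?S"
      by (simp only: sum.distrib sum_distrib_left)
    finally show ?thesis using w(2) by (simp add: algebra_simps)
  qed
  also have "\<dots> \<le> (\<Sum>j\<in>UNIV. w $ j * s j powr q)"
    using w assms by (intro sum_mono mult_left_mono powr_above_tangent) auto
  finally show ?thesis .
qed

text \<open>
  Strictness has two different sources. If the norms are equal, it comes from the strict convexity
  of the ball (the parallelogram law). If they differ, the triangle inequality suffices and it comes
  from the strict convexity of the power.
\<close>

lemma norm_powr_midpoint_less:
  fixes a b :: "'a::real_inner"
  assumes "q > 1" and "a \<noteq> b"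
  shows "norm ((1/2) *\<^sub>R (a + b)) powr q < (norm a powr q + norm b powr q) / 2"
proof (cases "norm a = norm b")
  case True
  have "(norm ((1/2) *\<^sub>R (a + b)))\<^sup>2 = ((norm a)\<^sup>2 + (norm b)\<^sup>2) / 2 - (norm (a - b))\<^sup>2 / 4"
    by (simp add: power2_norm_eq_inner inner_add inner_diff inner_commute field_simps)
  also have "\<dots> < (norm a)\<^sup>2"
    using assms True by simp
  finally have "norm ((1/2) *\<^sub>R (a + b)) < norm a"
    by (rule power2_less_imp_less) simp
  then have "norm ((1/2) *\<^sub>R (a + b)) powr q < norm a powr q"
    using assms by (intro powr_less_mono2) auto
  then show ?thesis using True by simp
next
  case False
  let ?\<mu> = "(norm a + norm b) / 2"
  have pos: "?\<mu> > 0"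
    using False by (smt (verit) norm_ge_zero half_gt_zero_iff)
  have "norm ((1/2) *\<^sub>R (a + b)) \<le> ?\<mu>"
    using norm_triangle_ineq[of a b] by simp
  then have "norm ((1/2) *\<^sub>R (a + b)) powr q \<le> ?\<mu> powr q"
    using assms by (intro powr_mono2) auto
  moreover have "?\<mu> powr q + q * ?\<mu> powr (q - 1) * (norm a - ?\<mu>) < norm a powr q"
    using pos False assms by (intro powr_strictly_above_tangent) auto
  moreover have "?\<mu> powr q + q * ?\<mu> powr (q - 1) * (norm b - ?\<mu>) < norm b powr q"
    using pos False assms by (intro powr_strictly_above_tangent) auto
  moreover have "q * ?\<mu> powr (q - 1) * (norm b - ?\<mu>) = - (q * ?\<mu> powr (q - 1) * (norm a - ?\<mu>))"
    by (simp add: algebra_simps)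
  ultimately show ?thesis by argo
qed

section \<open>Existence of minimizers\<close>

text \<open>
  With vanishing weights the objective need not be coercive on \<open>U\<close>, so a minimizing sequence may be
  unbounded. Absorbing the weights into the vectors removes the difficulty: the map \<open>D\<close> scales the
  components by \<open>w\<^sub>j\<^bsup>1/q\<^esup>\<close>, the image of \<open>U\<close> is again a subspace, hence closed, and there the
  unweighted objective \<open>g\<close> has bounded sublevel sets.
\<close>

lemma weighted_powr_attains_min_on_subspace:
  fixes U :: "('a::euclidean_space ^ 'm::finite) set" and w :: "real ^ 'm"
  assumes "subspace U" and "\<And>j. w $ j \<ge> 0" and "q > 0"
  shows "\<exists>u\<in>U. \<forall>v\<in>U. (\<Sum>j\<in>UNIV. w $ j * norm (y $ j - u $ j) powr q)
                      \<le> (\<Sum>j\<in>UNIV. w $ j * norm (y $ j - v $ j) powr q)"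
proof -
  define D where "D u = (\<chi> j. w $ j powr (1 / q) *\<^sub>R u $ j)" for u :: "'a ^ 'm"
  define g where "g z = (\<Sum>j\<in>UNIV. norm (z $ j) powr q)" for z :: "'a ^ 'm"
  have g_D: "g (D y - D u) = (\<Sum>j\<in>UNIV. w $ j * norm (y $ j - u $ j) powr q)" for u
    unfolding g_def
  proof (intro sum.cong refl)
    fix j
    have "(D y - D u) $ j = w $ j powr (1 / q) *\<^sub>R (y $ j - u $ j)"
      by (simp add: D_def scaleR_right_diff_distrib)
    then show "norm ((D y - D u) $ j) powr q = w $ j * norm (y $ j - u $ j) powr q"
      using assms(2)[of j] \<open>q > 0\<close> by (simp add: powr_mult powr_powr)
  qed
  have "linear D"
    by (rule linearI) (simp_all add: D_def vec_eq_iff scaleR_right_distrib)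
  then have "closed (D ` U)"
    using assms(1) by (intro closed_subspace linear_subspace_image)
  define A where "A = (\<lambda>z. D y - z) -` (D ` U)"
  have "closed A"
    unfolding A_def
    by (intro closed_vimage \<open>closed (D ` U)\<close>) (auto intro!: continuous_intros)
  let ?K = "A \<inter> {z. g z \<le> g (D y)}"
  have cont: "continuous_on UNIV g"
    unfolding g_def using \<open>q > 0\<close>
    by (intro continuous_on_sum continuous_on_powr') (auto intro!: continuous_intros)
  have "closed ?K"
    by (intro closed_Int \<open>closed A\<close> closed_Collect_le cont continuous_on_const)
  moreover have "bounded ?K"
  proof -
    have "norm z \<le> of_nat CARD('m) * g (D y) powr (1 / q)" if "g z \<le> g (D y)" for z
    proof -
      have "norm (z $ j) \<le> g (D y) powr (1 / q)" for j
      proof -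
        have "norm (z $ j) powr q \<le> g z"
          unfolding g_def by (rule member_le_sum) auto
        then have "(norm (z $ j) powr q) powr (1 / q) \<le> g (D y) powr (1 / q)"
          using that \<open>q > 0\<close> by (intro powr_mono2) auto
        then show ?thesis using \<open>q > 0\<close> by (simp add: powr_powr)
      qed
      then have "(\<Sum>j\<in>UNIV. norm (z $ j)) \<le> (\<Sum>j\<in>(UNIV::'m set). g (D y) powr (1 / q))"
        by (rule sum_mono)
      then show ?thesis
        using L2_set_le_sum[of UNIV "\<lambda>j. norm (z $ j)"] by (simp add: norm_vec_def)
    qed
    then show ?thesis by (auto simp: bounded_iff)
  qed
  ultimately have "compact ?K" by (simp add: compact_eq_bounded_closed)
  moreover have "D y \<in> ?K"
    using subspace_0[OF assms(1)] linear_0[OF \<open>linear D\<close>]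
    by (auto simp: A_def image_iff intro!: bexI[of _ 0])
  ultimately obtain z where z: "z \<in> ?K" "\<And>z'. z' \<in> ?K \<Longrightarrow> g z \<le> g z'"
    using continuous_attains_inf[of ?K g] continuous_on_subset[OF cont] by blast
  then obtain u where u: "u \<in> U" "D y - z = D u" by (auto simp: A_def)
  then have z_eq: "z = D y - D u" by (simp add: algebra_simps)
  have "g z \<le> g (D y - D v)" if "v \<in> U" for v
  proof (cases "g (D y - D v) \<le> g (D y)")
    case True
    then show ?thesis using that by (intro z(2)) (auto simp: A_def)
  next
    case False
    then show ?thesis using z(1) by auto
  qed
  then show ?thesis using u(1) by (auto simp: z_eq g_D)
qed

section \<open>A certificate for best uniform approximation\<close>

text \<open>
  If \<open>r\<close> is not extremal, a small step keeps its norm below \<open>\<eta>\<close>. If it is, the squared norm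
  changes at first order by \<open>2 e (a \<bullet> r)\<close>, which is a decrease.
\<close>

lemma eventually_norm_add_scaled_less:
  fixes a r :: "'a::real_inner"
  assumes "norm r \<le> \<eta>" and "norm r = \<eta> \<Longrightarrow> a \<bullet> r < 0"
  shows "\<forall>\<^sub>F e in at_right (0::real). norm (r + e *\<^sub>R a) < \<eta>"
proof (cases "norm r = \<eta>")
  case False
  have "((\<lambda>e. norm (r + e *\<^sub>R a)) \<longlongrightarrow> norm (r + 0 *\<^sub>R a)) (at_right (0::real))"
    by (intro tendsto_intros)
  then show ?thesis
    using False assms(1) by (intro order_tendstoD(2)) auto
next
  case True
  have "((\<lambda>e. 2 * (a \<bullet> r) + e * (a \<bullet> a)) \<longlongrightarrow> 2 * (a \<bullet> r) + 0 * (a \<bullet> a)) (at_right (0::real))"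
    by (intro tendsto_intros)
  then have "\<forall>\<^sub>F e in at_right (0::real). 2 * (a \<bullet> r) + e * (a \<bullet> a) < 0"
    using assms(2)[OF True] by (elim order_tendstoD(2)) simp
  moreover have "\<forall>\<^sub>F e in at_right (0::real). e > 0"
    by (rule eventually_at_right_less)
  ultimately show ?thesis
  proof eventually_elim
    case (elim e)
    have "(norm (r + e *\<^sub>R a))\<^sup>2 = (norm r)\<^sup>2 + e * (2 * (a \<bullet> r) + e * (a \<bullet> a))"
      unfolding power2_norm_eq_inner by (simp add: inner_add inner_commute algebra_simps)
    also have "\<dots> < \<eta>\<^sup>2"
      using elim True by (simp add: mult_pos_neg)
    finally show ?case
      using True by (intro power2_less_imp_less[of _ \<eta>]) auto
  qed
qed

text \<open>
  A vector \<open>(w\<^sub>j r\<^sub>j)\<^sub>j\<close> with weights on the extremal indices is a point of the polytope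
  \<open>convex hull S\<close>, and the claim is that this polytope meets the orthogonal complement of \<open>U\<close>.
  Otherwise a hyperplane with normal \<open>a\<close> separates the two. As \<open>a\<close> is bounded below on a subspace it
  vanishes there, so \<open>a\<close> belongs to the double complement \<open>U\<close>; and it makes an obtuse angle with
  every extremal residual, so that adding a small multiple of \<open>a\<close> to \<open>r\<close> lowers the maximum.
\<close>

lemma best_uniform_residual_certificate:
  fixes U :: "('a::euclidean_space ^ 'm::finite) set" and r :: "'a ^ 'm"
  assumes "subspace U" and "\<eta> > 0" and "\<And>j. norm (r $ j) \<le> \<eta>"
    and best: "\<And>u. u \<in> U \<Longrightarrow> \<exists>j. norm (r $ j + u $ j) \<ge> \<eta>"
  shows "\<exists>w\<in>prob_simplex. (\<forall>j. w $ j \<noteq> 0 \<longrightarrow> norm (r $ j) = \<eta>) \<and>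
           (\<forall>u\<in>U. (\<Sum>j\<in>UNIV. w $ j * (u $ j \<bullet> r $ j)) = 0)"
proof -
  define E where "E = {j. norm (r $ j) = \<eta>}"
  define S where "S = (\<lambda>j. axis j (r $ j)) ` E"
  have inj: "inj_on (\<lambda>j. axis j (r $ j)) E"
  proof (rule inj_onI)
    fix i j assume "i \<in> E" "j \<in> E" "axis i (r $ i) = axis j (r $ j)"
    then show "i = j"
      using \<open>\<eta> > 0\<close> by (auto simp: E_def axis_eq_axis)
  qed
  have "E \<noteq> {}"
  proof -
    obtain j where "norm (r $ j + 0 $ j) \<ge> \<eta>"
      using best[OF subspace_0[OF assms(1)]] by blast
    then show ?thesis using assms(3)[of j] by (auto simp: E_def)
  qed
  have "convex hull S \<inter> U\<^sup>\<bottom> \<noteq> {}"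
  proof
    assume disj: "convex hull S \<inter> U\<^sup>\<bottom> = {}"
    have "compact (convex hull S)"
      by (intro finite_imp_compact_convex_hull) (simp add: S_def)
    moreover have "convex hull S \<noteq> {}"
      using \<open>E \<noteq> {}\<close> by (simp add: S_def)
    ultimately have "\<exists>a b. (\<forall>c\<in>convex hull S. a \<bullet> c < b) \<and> (\<forall>v\<in>U\<^sup>\<bottom>. a \<bullet> v > b)"
      using disj subspace_orthogonal_comp[of U]
      by (intro separating_hyperplane_compact_closed)
        (auto intro: closed_subspace subspace_imp_convex)
    then obtain a b where below: "\<And>c. c \<in> convex hull S \<Longrightarrow> a \<bullet> c < b"
        and above: "\<And>v. v \<in> U\<^sup>\<bottom> \<Longrightarrow> a \<bullet> v > b"
      by blast
    have "b < 0"
      using above[of 0] by (simp add: subspace_0 subspace_orthogonal_comp)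
    have "a \<bullet> v = 0" if "v \<in> U\<^sup>\<bottom>" for v
    proof (rule ccontr)
      assume "a \<bullet> v \<noteq> 0"
      then show False
        \<comment> \<open>On this multiple of \<open>v\<close> the functional takes exactly the value \<open>b\<close>.\<close>
        using above[of "(b / (a \<bullet> v)) *\<^sub>R v"] that
        by (simp add: subspace_scale subspace_orthogonal_comp)
    qed
    then have "a \<in> (U\<^sup>\<bottom>)\<^sup>\<bottom>"
      by (auto simp: orthogonal_comp_def orthogonal_def inner_commute)
    then have "a \<in> U"
      using orthogonal_comp_self[OF assms(1)] by simp
    \<comment> \<open>\<open>b\<close> is negative since \<open>0\<close> lies on the upper side, so \<open>a\<close> is negative on all of \<open>S\<close>.\<close>
    have descent: "a $ j \<bullet> r $ j < 0" if "norm (r $ j) = \<eta>" for j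
      using below[of "axis j (r $ j)"] that \<open>b < 0\<close>
      by (auto simp: S_def E_def inner_axis hull_inc)
    have "\<forall>\<^sub>F e in at_right (0::real). \<forall>j\<in>UNIV. norm (r $ j + e *\<^sub>R a $ j) < \<eta>"
      by (intro eventually_ball_finite ballI eventually_norm_add_scaled_less assms(3) descent) auto
    then obtain e :: real where e: "\<And>j. norm (r $ j + e *\<^sub>R a $ j) < \<eta>"
      using eventually_happens[of _ "at_right (0::real)"] by auto
    obtain j where "norm (r $ j + (e *\<^sub>R a) $ j) \<ge> \<eta>"
      using best[OF subspace_scale[OF assms(1) \<open>a \<in> U\<close>]] by blast
    then show False using e[of j] by simp
  qed
  then obtain c where c: "c \<in> convex hull S" "c \<in> U\<^sup>\<bottom>" by blast
  obtain \<alpha> where \<alpha>: "\<And>s. s \<in> S \<Longrightarrow> \<alpha> s \<ge> (0::real)" "sum \<alpha> S = 1" "(\<Sum>s\<in>S. \<alpha> s *\<^sub>R s) = c"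
    using c(1) by (auto simp: convex_hull_finite S_def)
  define w :: "real ^ 'm" where "w = (\<chi> j. if j \<in> E then \<alpha> (axis j (r $ j)) else 0)"
  have "(\<Sum>j\<in>UNIV. w $ j) = sum \<alpha> S"
    unfolding S_def by (simp add: w_def sum.reindex[OF inj] sum.If_cases)
  then have "w \<in> prob_simplex"
    using \<alpha> by (auto simp: prob_simplex_def w_def S_def)
  moreover have "\<forall>j. w $ j \<noteq> 0 \<longrightarrow> norm (r $ j) = \<eta>"
    by (auto simp: w_def E_def)
  moreover have "(\<Sum>j\<in>UNIV. w $ j * (u $ j \<bullet> r $ j)) = 0" if "u \<in> U" for u
  proof -
    have "(\<Sum>j\<in>UNIV. w $ j * (u $ j \<bullet> r $ j)) =
        (\<Sum>j\<in>UNIV. if j \<in> E then \<alpha> (axis j (r $ j)) * (u $ j \<bullet> r $ j) else 0)"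
      by (intro sum.cong) (auto simp: w_def)
    also have "\<dots> = (\<Sum>j\<in>E. \<alpha> (axis j (r $ j)) * (u \<bullet> axis j (r $ j)))"
      by (simp add: sum.If_cases inner_axis)
    also have "\<dots> = u \<bullet> c"
      unfolding \<alpha>(3)[symmetric] by (simp add: S_def sum.reindex[OF inj] inner_sum_right)
    also have "\<dots> = 0"
      using c(2) that by (simp add: orthogonal_comp_def orthogonal_def)
    finally show ?thesis .
  qed
  ultimately show ?thesis by blast
qed


text \<open>
  Orthogonality makes the weighted pairing with \<open>r\<close> the same for \<open>r + u\<close> as for \<open>r\<close> itself, namely
  \<open>\<eta>\<^sup>2\<close>; the Cauchy--Schwarz inequality in each component bounds it by \<open>\<eta>\<close> times the weighted mean
  of the norms.
\<close>

lemma certificate_imp_weighted_powr_ge: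
  fixes r u :: "'a::real_inner ^ 'm::finite"
  assumes "w \<in> prob_simplex" and "\<eta> > 0" and "q \<ge> 1"
    and supp: "\<And>j. w $ j \<noteq> 0 \<Longrightarrow> norm (r $ j) = \<eta>"
    and orth: "(\<Sum>j\<in>UNIV. w $ j * (u $ j \<bullet> r $ j)) = 0"
  shows "\<eta> powr q \<le> (\<Sum>j\<in>UNIV. w $ j * norm (r $ j + u $ j) powr q)"
proof (rule powr_weighted_mean_ge)
  have w: "\<And>j. w $ j \<ge> 0" "(\<Sum>j\<in>UNIV. w $ j) = 1"
    using assms(1) by (auto simp: prob_simplex_def)
  have "\<eta> * \<eta> = (\<Sum>j\<in>UNIV. w $ j) * (\<eta> * \<eta>)"
    using w(2) by simp
  also have "\<dots> = (\<Sum>j\<in>UNIV. w $ j * (r $ j \<bullet> r $ j))"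
    unfolding sum_distrib_right
  proof (intro sum.cong refl)
    fix j show "w $ j * (\<eta> * \<eta>) = w $ j * (r $ j \<bullet> r $ j)"
      using supp[of j] by (cases "w $ j = 0") (auto simp: norm_eq_sqrt_inner)
  qed
  also have "\<dots> = (\<Sum>j\<in>UNIV. w $ j * ((r $ j + u $ j) \<bullet> r $ j))"
    using orth by (simp add: inner_add_left distrib_left sum.distrib)
  also have "\<dots> \<le> (\<Sum>j\<in>UNIV. w $ j * (norm (r $ j + u $ j) * \<eta>))"
  proof (intro sum_mono)
    fix j
    show "w $ j * ((r $ j + u $ j) \<bullet> r $ j) \<le> w $ j * (norm (r $ j + u $ j) * \<eta>)"
      using supp[of j] norm_cauchy_schwarz[of "r $ j + u $ j" "r $ j"] w(1)[of j]
      by (cases "w $ j = 0") (auto intro: mult_left_mono)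
  qed
  also have "\<dots> = (\<Sum>j\<in>UNIV. w $ j * norm (r $ j + u $ j)) * \<eta>"
    by (simp add: sum_distrib_right mult.assoc)
  finally show "\<eta> \<le> (\<Sum>j\<in>UNIV. w $ j * norm (r $ j + u $ j))"
    using \<open>\<eta> > 0\<close> by simp
qed (use assms in auto)

section \<open>Interpolation under the Haar condition\<close>

text \<open>
  In terms of the coefficient vector \<open>c\<close> interpolation is the linear system \<open>c v* A = b\<close> whose
  matrix is the one that the Haar condition declares invertible.
\<close>

lemma haar_unique_interpolation:
  fixes \<psi> :: "'n::finite \<Rightarrow> complex \<Rightarrow> complex"
  assumes "haar_condition \<Omega> \<psi>" and "T \<subseteq> \<Omega>" and "card T = CARD('n)"
  shows "\<exists>!p. p \<in> span_on \<Omega> \<psi> \<and> (\<forall>z\<in>T. p z = y z)"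
proof -
  have "finite T"
    using assms(3) card_ge_0_finite by force
  then obtain g :: "'n \<Rightarrow> complex" where g: "bij_betw g UNIV T"
    using finite_same_card_bij[of "UNIV :: 'n set" T] assms(3) by auto
  define A :: "complex ^ 'n ^ 'n" where "A = (\<chi> i j. \<psi> i (g j))"
  have "invertible A"
    using assms(1,2) g unfolding haar_condition_def A_def
    by (auto simp: bij_betw_def)
  then obtain B where B: "A ** B = mat 1" "B ** A = mat 1"
    by (auto simp: invertible_def)
  define P where "P c = (\<lambda>z\<in>\<Omega>. \<Sum>i\<in>UNIV. c $ i * \<psi> i z)" for c :: "complex ^ 'n"
  have span: "p \<in> span_on \<Omega> \<psi> \<longleftrightarrow> (\<exists>c. p = P c)" for p
  proof
    assume "p \<in> span_on \<Omega> \<psi>"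
    then obtain c where "p = (\<lambda>z\<in>\<Omega>. \<Sum>i\<in>UNIV. c i * \<psi> i z)"
      by (auto simp: span_on_def)
    then have "p = P (\<chi> i. c i)" by (simp add: P_def)
    then show "\<exists>c. p = P c" ..
  qed (auto simp: span_on_def P_def)
  have interp: "(\<forall>z\<in>T. P c z = y z) \<longleftrightarrow> c v* A = (\<chi> j. y (g j))" for c
  proof -
    have "(\<forall>z\<in>T. P c z = y z) \<longleftrightarrow> (\<forall>j. P c (g j) = y (g j))"
      using g by (auto simp: bij_betw_def)
    also have "\<dots> \<longleftrightarrow> (\<forall>j. (c v* A) $ j = y (g j))"
      using g assms(2) by (auto simp: P_def A_def vector_matrix_mult_def bij_betw_def subset_iff)
    finally show ?thesis by (simp add: vec_eq_iff)
  qed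
  have solve: "c v* A = b \<longleftrightarrow> c = b v* B" for b c :: "complex ^ 'n"
    using B by (auto simp: vector_matrix_mul_assoc)
  show ?thesis
    by (rule ex1I[of _ "P ((\<chi> j. y (g j)) v* B)"]) (auto simp: span interp solve)
qed

section \<open>The span as an approximation space\<close>

lemma subspace_node_values:
  fixes \<psi> :: "'n::finite \<Rightarrow> complex \<Rightarrow> complex" and x :: "'m::finite \<Rightarrow> complex"
  assumes "range x \<subseteq> \<Omega>"
  shows "subspace ((\<lambda>p. \<chi> j. p (x j)) ` span_on \<Omega> \<psi>)"
proof -
  define L :: "complex ^ 'n \<Rightarrow> complex ^ 'm" where "L c = (\<chi> j. \<Sum>i\<in>UNIV. c $ i * \<psi> i (x j))" for c
  have "linear L"
    by (rule linearI)
      (simp_all add: L_def vec_eq_iff distrib_right sum.distrib scaleR_sum_right)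
  moreover have "(\<lambda>p. \<chi> j. p (x j)) ` span_on \<Omega> \<psi> = range L"
  proof (intro set_eqI iffI)
    fix u assume "u \<in> (\<lambda>p. \<chi> j. p (x j)) ` span_on \<Omega> \<psi>"
    then obtain c where "u = (\<chi> j. (\<lambda>z\<in>\<Omega>. \<Sum>i\<in>UNIV. c i * \<psi> i z) (x j))"
      by (auto simp: span_on_def)
    then have "u = L (\<chi> i. c i)"
      using assms by (auto simp: L_def vec_eq_iff)
    then show "u \<in> range L" by blast
  next
    fix u assume "u \<in> range L"
    then obtain c where "u = L c" by blast
    then have "u = (\<chi> j. (\<lambda>z\<in>\<Omega>. \<Sum>i\<in>UNIV. c $ i * \<psi> i z) (x j))"
      using assms by (simp add: L_def vec_eq_iff image_subset_iff)
    moreover have "(\<lambda>z\<in>\<Omega>. \<Sum>i\<in>UNIV. c $ i * \<psi> i z) \<in> span_on \<Omega> \<psi>"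
      by (auto simp: span_on_def)
    ultimately show "u \<in> (\<lambda>p. \<chi> j. p (x j)) ` span_on \<Omega> \<psi>" by blast
  qed
  ultimately show ?thesis
    by (simp add: linear_subspace_image)
qed

lemma span_on_midpoint:
  assumes "p \<in> span_on \<Omega> \<psi>" and "p' \<in> span_on \<Omega> \<psi>"
  shows "(\<lambda>z\<in>\<Omega>. (1/2) *\<^sub>R (p z + p' z)) \<in> span_on \<Omega> \<psi>"
proof -
  obtain c c' where "p = (\<lambda>z\<in>\<Omega>. \<Sum>i\<in>UNIV. c i * \<psi> i z)" "p' = (\<lambda>z\<in>\<Omega>. \<Sum>i\<in>UNIV. c' i * \<psi> i z)"
    using assms by (auto simp: span_on_def)
  then have "(\<lambda>z\<in>\<Omega>. (1/2) *\<^sub>R (p z + p' z)) =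
      (\<lambda>z\<in>\<Omega>. \<Sum>i\<in>UNIV. ((1/2) *\<^sub>R (c i + c' i)) * \<psi> i z)"
    by (auto simp: fun_eq_iff sum.distrib distrib_right scaleR_sum_right scaleR_right_distrib)
  then show ?thesis
    unfolding span_on_def mem_Collect_eq by (intro exI[of _ "\<lambda>i. (1/2) *\<^sub>R (c i + c' i)"])
qed

section \<open>Duality between the minimax and the weighted problems\<close>

lemma dual_fun_eq_weighted_error:
  assumes "is_arg_min (weighted_error f x q w) (\<lambda>p. p \<in> span_on \<Omega> \<psi>) p"
  shows "dual_fun \<Omega> \<psi> f x q w = weighted_error f x q w p"
  using assms unfolding dual_fun_def is_arg_min_linorder
  by (intro cInf_eq_minimum) auto

lemma weighted_error_attains_min:
  fixes \<psi> :: "'n::finite \<Rightarrow> complex \<Rightarrow> complex" and x :: "'m::finite \<Rightarrow> complex"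
  assumes "range x \<subseteq> \<Omega>" and "w \<in> prob_simplex" and "q > 0"
  shows "\<exists>p. is_arg_min (weighted_error f x q w) (\<lambda>p. p \<in> span_on \<Omega> \<psi>) p"
proof -
  have "\<And>j. w $ j \<ge> 0"
    using assms(2) by (simp add: prob_simplex_def)
  from weighted_powr_attains_min_on_subspace[OF subspace_node_values[OF assms(1), of \<psi>] this assms(3),
      of "\<chi> j. f (x j)"]
  show ?thesis
    by (auto simp: is_arg_min_linorder weighted_error_def)
qed

theorem theorem2p1:
  fixes \<Omega> :: "complex set"
    and \<psi> :: "'n::finite \<Rightarrow> complex \<Rightarrow> complex"
    and f :: "complex \<Rightarrow> complex"
    and x :: "'m::finite \<Rightarrow> complex"
    and pstar :: "complex \<Rightarrow> complex"
    and \<eta> :: real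
  assumes "compact \<Omega>"
    and "\<And>i. continuous_on \<Omega> (\<psi> i)"
    and "lin_indep_on \<Omega> \<psi>"
    and "haar_condition \<Omega> \<psi>"
    and "inj x" and "range x \<subseteq> \<Omega>"
    and "CARD('m) \<ge> CARD('n) + 1"
    and "is_arg_min (max_error f x) (\<lambda>p. p \<in> span_on \<Omega> \<psi>) pstar"
    and "\<eta> = max_error f x pstar"
    and "\<eta> > 0"
  shows
    "(\<forall>q\<ge>1.
        (\<forall>w\<in>prob_simplex. \<exists>p. is_arg_min (weighted_error f x q w) (\<lambda>p. p \<in> span_on \<Omega> \<psi>) p) \<and>
        (\<exists>w. is_arg_max (dual_fun \<Omega> \<psi> f x q) (\<lambda>w. w \<in> prob_simplex) w) \<and>
        \<eta> = (SUP w\<in>prob_simplex. dual_fun \<Omega> \<psi> f x q w) powr (1 / q) \<and>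
        (\<forall>w. is_arg_max (dual_fun \<Omega> \<psi> f x q) (\<lambda>w. w \<in> prob_simplex) w \<longrightarrow>
           card {j. w $ j \<noteq> 0} \<ge> CARD('n) + 1 \<and>
           (\<forall>j. w $ j * (\<eta> - cmod (f (x j) - pstar (x j))) = 0)))
     \<and>
     (\<forall>q>1. \<forall>w. is_arg_max (dual_fun \<Omega> \<psi> f x q) (\<lambda>w. w \<in> prob_simplex) w \<longrightarrow>
        dual_fun \<Omega> \<psi> f x q w = \<eta> powr q \<and>
        (\<forall>p. is_arg_min (weighted_error f x q w) (\<lambda>p. p \<in> span_on \<Omega> \<psi>) p \<longleftrightarrow> p = pstar))"
proof -
  note haar = assms(4) and nodes = assms(6) and card_nodes = assms(7) and \<eta>_pos = assms(10)
  let ?V = "\<lambda>p. (\<chi> j. p (x j)) :: complex ^ 'm"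
  let ?U = "?V ` span_on \<Omega> \<psi>"
  let ?E = "weighted_error f x" and ?d = "dual_fun \<Omega> \<psi> f x"
  define r :: "complex ^ 'm" where "r = (\<chi> j. f (x j) - pstar (x j))"
  have U: "subspace ?U"
    by (rule subspace_node_values) fact
  have pstar: "pstar \<in> span_on \<Omega> \<psi>"
      "\<And>p. p \<in> span_on \<Omega> \<psi> \<Longrightarrow> \<eta> \<le> max_error f x p"
    using assms(8,9) by (auto simp: is_arg_min_linorder)
  have r_le: "norm (r $ j) \<le> \<eta>" for j
    by (simp add: assms(9) max_error_def r_def)

  have attained: "\<exists>p. is_arg_min (?E q w) (\<lambda>p. p \<in> span_on \<Omega> \<psi>) p"
    if "q \<ge> 1" "w \<in> prob_simplex" for q w
    using that by (intro weighted_error_attains_min[OF nodes]) auto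
  have dual_le: "?d q w \<le> ?E q w p"
    if "q \<ge> 1" "w \<in> prob_simplex" "p \<in> span_on \<Omega> \<psi>" for q w p
    using attained[OF that(1,2)] that(3) dual_fun_eq_weighted_error[of f x q w \<Omega> \<psi>]
    by (metis is_arg_min_linorder)
  have error_pstar_le: "?E q w pstar \<le> \<eta> powr q"
    if "q \<ge> 1" "w \<in> prob_simplex" for q w
  proof -
    have "?E q w pstar \<le> (\<Sum>j\<in>UNIV. w $ j * \<eta> powr q)"
      unfolding weighted_error_def using that r_le
      by (intro sum_mono mult_left_mono powr_mono2) (auto simp: prob_simplex_def r_def)
    also have "\<dots> = \<eta> powr q"
      using that(2) by (simp add: prob_simplex_def flip: sum_distrib_right)
    finally show ?thesis .
  qed

  \<comment> \<open>\<open>r + u\<close> is the residual of a member of the span, so optimality of \<open>pstar\<close> applies to it.\<close>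
  have "\<exists>j. \<eta> \<le> norm (r $ j + u $ j)" if "u \<in> ?U" for u
  proof -
    have "?V pstar - u \<in> ?U"
      using U that pstar(1) by (intro subspace_diff) auto
    then obtain p where p: "p \<in> span_on \<Omega> \<psi>" "?V pstar - u = ?V p" by blast
    have "max_error f x p \<in> range (\<lambda>j. cmod (f (x j) - p (x j)))"
      unfolding max_error_def by (rule Max_in) auto
    then obtain j where "max_error f x p = cmod (f (x j) - p (x j))" by blast
    moreover have "f (x j) - p (x j) = r $ j + u $ j"
      using arg_cong[OF p(2), of "\<lambda>v. v $ j"] by (simp add: r_def algebra_simps)
    ultimately show ?thesis using pstar(2)[OF p(1)] by auto
  qed
  from best_uniform_residual_certificate[OF U \<eta>_pos r_le this]
  obtain w0 where w0: "w0 \<in> prob_simplex" "\<And>j. w0 $ j \<noteq> 0 \<Longrightarrow> norm (r $ j) = \<eta>"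
      "\<And>u. u \<in> ?U \<Longrightarrow> (\<Sum>j\<in>UNIV. w0 $ j * (u $ j \<bullet> r $ j)) = 0"
    by blast
  have dual_w0: "\<eta> powr q \<le> ?d q w0" if q: "q \<ge> 1" for q
  proof -
    obtain p where p: "is_arg_min (?E q w0) (\<lambda>p. p \<in> span_on \<Omega> \<psi>) p"
      using attained[OF q w0(1)] by blast
    then have "?V pstar - ?V p \<in> ?U"
      using U pstar(1) by (intro subspace_diff) (auto simp: is_arg_min_def)
    from certificate_imp_weighted_powr_ge[OF w0(1) \<eta>_pos q w0(2) w0(3)[OF this]]
    have "\<eta> powr q \<le> ?E q w0 p"
      by (simp add: weighted_error_def r_def)
    then show ?thesis
      by (simp add: dual_fun_eq_weighted_error[OF p])
  qed
  have dual_upper: "?d q w \<le> \<eta> powr q" if "q \<ge> 1" "w \<in> prob_simplex" for q w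
    using dual_le[OF that pstar(1)] error_pstar_le[OF that] by simp
  have dual_w0_eq: "?d q w0 = \<eta> powr q" if "q \<ge> 1" for q
    using dual_w0[OF that] dual_upper[OF that w0(1)] by simp
  have maximizer: "w \<in> prob_simplex" "?d q w = \<eta> powr q"
    if "q \<ge> 1" "is_arg_max (?d q) (\<lambda>w. w \<in> prob_simplex) w" for q w
  proof -
    show "w \<in> prob_simplex" using that(2) by (simp add: is_arg_max_linorder)
    then show "?d q w = \<eta> powr q"
      using that(2) dual_upper[OF that(1), of w] dual_w0_eq[OF that(1)] w0(1)
      by (force simp: is_arg_max_linorder)
  qed
  have error_pstar: "?E q w pstar = \<eta> powr q"
    if "q \<ge> 1" "is_arg_max (?d q) (\<lambda>w. w \<in> prob_simplex) w" for q w
    using dual_le[OF that(1) maximizer(1)[OF that] pstar(1)] maximizer[OF that]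
      error_pstar_le[OF that(1)] by fastforce

  have sup: "(SUP w\<in>prob_simplex. ?d q w) powr (1 / q) = \<eta>" if "q \<ge> 1" for q
  proof -
    have "(SUP w\<in>prob_simplex. ?d q w) = \<eta> powr q"
      using w0(1) dual_w0_eq[OF that] dual_upper[OF that]
      by (intro cSup_eq_maximum) (auto intro: rev_image_eqI)
    then show ?thesis using \<eta>_pos that by (simp add: powr_powr)
  qed

  have slack: "w $ j * (\<eta> - cmod (f (x j) - pstar (x j))) = 0"
    if "q \<ge> 1" "is_arg_max (?d q) (\<lambda>w. w \<in> prob_simplex) w" for q w j
  proof -
    have w: "\<And>j. w $ j \<ge> 0" "(\<Sum>j\<in>UNIV. w $ j) = 1"
      using maximizer(1)[OF that] by (auto simp: prob_simplex_def)
    have gap: "norm (r $ i) powr q \<le> \<eta> powr q" for i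
      using r_le[of i] that(1) by (intro powr_mono2) auto
    have "(\<Sum>i\<in>UNIV. w $ i * (\<eta> powr q - norm (r $ i) powr q)) = \<eta> powr q - ?E q w pstar"
      using w(2) by (simp add: weighted_error_def r_def right_diff_distrib sum_subtractf
          flip: sum_distrib_right)
    then have "(\<Sum>i\<in>UNIV. w $ i * (\<eta> powr q - norm (r $ i) powr q)) = 0"
      using error_pstar[OF that] by simp
    then have "w $ j * (\<eta> powr q - norm (r $ j) powr q) = 0"
      using w(1) gap by (subst (asm) sum_nonneg_eq_0_iff) auto
    moreover have "norm (r $ j) = \<eta>" if eq: "\<eta> powr q = norm (r $ j) powr q"
      using powr_inj[of q] eq r_le[of j] \<eta>_pos \<open>q \<ge> 1\<close> powr_less_mono2[of q "norm (r $ j)" \<eta>]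
      by force
    ultimately show ?thesis by (auto simp: r_def)
  qed

  have support: "card {j. w $ j \<noteq> 0} \<ge> CARD('n) + 1"
    if "q \<ge> 1" "is_arg_max (?d q) (\<lambda>w. w \<in> prob_simplex) w" for q w
  proof (rule ccontr)
    assume "\<not> ?thesis"
    \<comment> \<open>At most \<open>n\<close> nodes matter; filled up to exactly \<open>n\<close>, they admit interpolation of \<open>f\<close>.\<close>
    then obtain J where J: "{j. w $ j \<noteq> 0} \<subseteq> J" "card J = CARD('n)"
      using exists_subset_between[of "{j. w $ j \<noteq> 0}" "CARD('n)" UNIV] card_nodes by auto
    have "\<exists>!p. p \<in> span_on \<Omega> \<psi> \<and> (\<forall>z\<in>x ` J. p z = f z)"
      using J(2) nodes \<open>inj x\<close>
      by (intro haar_unique_interpolation[OF haar]) (auto simp: card_image inj_on_subset)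
    then obtain p where p: "p \<in> span_on \<Omega> \<psi>" "\<forall>z\<in>x ` J. p z = f z"
      by blast
    then have "?E q w p = 0"
      using J(1) unfolding weighted_error_def by (intro sum.neutral) force
    then show False
      using dual_le[OF that(1) maximizer(1)[OF that] p(1)] maximizer(2)[OF that] \<eta>_pos by simp
  qed

  have unique: "p = pstar"
    if q: "q > 1" and w: "is_arg_max (?d q) (\<lambda>w. w \<in> prob_simplex) w"
      and p: "p \<in> span_on \<Omega> \<psi>" "?E q w p = \<eta> powr q" for q w p
  proof -
    have q1: "q \<ge> 1" using q by simp
    have w_nonneg: "\<And>j. w $ j \<ge> 0"
      using maximizer(1)[OF q1 w] by (auto simp: prob_simplex_def)
    let ?s = "\<lambda>j. f (x j) - p (x j)"
    define m where "m = (\<lambda>z\<in>\<Omega>. (1/2) *\<^sub>R (p z + pstar z))"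
    have m_node: "f (x j) - m (x j) = (1/2) *\<^sub>R (?s j + r $ j)" for j
    proof -
      have "x j \<in> \<Omega>" using nodes by auto
      then show ?thesis by (simp add: m_def r_def scaleR_conv_of_real field_simps)
    qed
    \<comment> \<open>The convexity defect at each node; its weighted sum cannot be positive, since the
      midpoint \<open>m\<close> has weighted error at least \<open>\<eta> powr q\<close>.\<close>
    let ?gap = "\<lambda>j. (norm (?s j) powr q + norm (r $ j) powr q) / 2 - norm (f (x j) - m (x j)) powr q"
    have gap_pos: "?gap j > 0" if "?s j \<noteq> r $ j" for j
      using norm_powr_midpoint_less[OF q that] unfolding m_node by simp
    have gap_nonneg: "?gap j \<ge> 0" for j
    proof (cases "?s j = r $ j")
      case True
      then show ?thesis unfolding m_node by (simp add: scaleR_2[symmetric])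
    qed (use gap_pos in force)
    have "(\<Sum>j\<in>UNIV. w $ j * ?gap j) = (?E q w p + ?E q w pstar) / 2 - ?E q w m"
      by (simp add: weighted_error_def r_def right_diff_distrib sum_subtractf distrib_left
          add_divide_distrib sum.distrib sum_divide_distrib)
    also have "\<dots> \<le> 0"
      using dual_le[OF q1 maximizer(1)[OF q1 w] span_on_midpoint[OF p(1) pstar(1)]]
        maximizer(2)[OF q1 w] p(2) error_pstar[OF q1 w] by (simp add: m_def)
    finally have "(\<Sum>j\<in>UNIV. w $ j * ?gap j) = 0"
      using gap_nonneg w_nonneg by (intro antisym sum_nonneg mult_nonneg_nonneg)
    then have "\<forall>j. w $ j * ?gap j = 0"
      using gap_nonneg w_nonneg by (subst (asm) sum_nonneg_eq_0_iff) (auto intro: mult_nonneg_nonneg)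
    then have agree: "p (x j) = pstar (x j)" if "w $ j \<noteq> 0" for j
      using gap_pos[of j] that by (force simp: r_def)
    obtain J where J: "J \<subseteq> {j. w $ j \<noteq> 0}" "card J = CARD('n)"
      using support[OF q1 w] obtain_subset_with_card_n[of "CARD('n)" "{j. w $ j \<noteq> 0}"] by auto
    have "\<exists>!p. p \<in> span_on \<Omega> \<psi> \<and> (\<forall>z\<in>x ` J. p z = pstar z)"
      using J nodes \<open>inj x\<close>
      by (intro haar_unique_interpolation[OF haar]) (auto simp: card_image inj_on_subset)
    moreover have "\<forall>z\<in>x ` J. p z = pstar z"
      using J(1) agree by auto
    ultimately show ?thesis using p(1) pstar(1) by blast
  qed

  have minimizer_iff: "is_arg_min (?E q w) (\<lambda>p. p \<in> span_on \<Omega> \<psi>) p \<longleftrightarrow> p = pstar"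
    if "q > 1" "is_arg_max (?d q) (\<lambda>w. w \<in> prob_simplex) w" for q w p
  proof
    have q1: "q \<ge> 1" using that(1) by simp
    show "p = pstar" if "is_arg_min (?E q w) (\<lambda>p. p \<in> span_on \<Omega> \<psi>) p"
    proof (rule unique)
      show "p \<in> span_on \<Omega> \<psi>" using that by (simp add: is_arg_min_def)
      show "?E q w p = \<eta> powr q"
        using dual_fun_eq_weighted_error[OF that]
          maximizer(2)[OF q1 \<open>is_arg_max (?d q) (\<lambda>w. w \<in> prob_simplex) w\<close>] by simp
    qed fact+
    show "is_arg_min (?E q w) (\<lambda>p. p \<in> span_on \<Omega> \<psi>) p" if "p = pstar"
      using dual_le[OF q1 maximizer(1)[OF q1 \<open>is_arg_max (?d q) (\<lambda>w. w \<in> prob_simplex) w\<close>]]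
        maximizer(2)[OF q1 \<open>is_arg_max (?d q) (\<lambda>w. w \<in> prob_simplex) w\<close>]
        error_pstar[OF q1 \<open>is_arg_max (?d q) (\<lambda>w. w \<in> prob_simplex) w\<close>] pstar(1) that
      by (simp add: is_arg_min_linorder)
  qed

  have "\<exists>w. is_arg_max (?d q) (\<lambda>w. w \<in> prob_simplex) w" if "q \<ge> 1" for q
    using w0(1) dual_w0_eq[OF that] dual_upper[OF that]
    by (intro exI[of _ w0]) (simp add: is_arg_max_linorder)
  then show ?thesis
    using attained sup support slack maximizer(2) minimizer_iff by (auto simp: less_imp_le)
qed

end
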